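(* Let $V_->V_+>0$ and $0<\rho_+<\rho^*<\rho_-<1$ with $f_-(\rho_-)=f_+(\rho_+)$. Then there exists no profile $Q:\mathbb{R}\to(0,1)$ that satisfies $$Q'(x)=\begin{cases}\dfrac{Q(x)^2}{\ell\,\phi(Q(x))}\left[\phi(Q(x))-\phi(Q(x^\sharp))\right], & x^\sharp<0\ \text{or}\ x>0,\\[2mm] \dfrac{Q(x)^2}{\ell\,V_-\phi(Q(x))}\left[V_-\phi(Q(x))-V_+\phi(Q(x^\sharp))\right], & x<0<x^\sharp,\end{cases}\qquad x^\sharp=x+\frac{\ell}{Q(x)},$$ and the boundary conditions $\lim_{x\to-\infty}Q(x)=\rho_-$ and $\lim_{x\to+\infty}Q(x)=\rho_+$.
   Context: Standing setting: $\ell>0$ is the car length. $\phi:[0,1]\to[0,1]$ is twice differentiable with $\phi'\le-\hat c_0<0$, $\phi(0)=1$, $\phi(1)=0$, and is such that $f_\pm(\rho)=V_\pm\,\rho\,\phi(\rho)$ satisfy $f_\pm''\le -c_0<0$ for some constant $c_0>0$. $\rho^*\in(0,1)$ is the unique point with $f_-'(\rho^* )=f_+'(\rho^* )=0$. Profiles $Q$ are continuous on $\mathbb{R}$, possibly with kinks; the derivative in the equation is understood as a left derivative, and the equation is not imposed at points where $x=0$ or $x^\sharp=0$. *)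

theory Defs
  imports "HOL-Analysis.Analysis"
begin

text \<open>
  The derivative of a function on \<open>[0,1]\<close>, one-sided at the two end points. It is meaningful
  only where the function is differentiable within \<open>[0,1]\<close>, and then uniquely determined.
\<close>

definition deriv01 :: "(real \<Rightarrow> real) \<Rightarrow> real \<Rightarrow> real" where
  "deriv01 g r = vector_derivative g (at r within {0..1})"

definition flux :: "real \<Rightarrow> (real \<Rightarrow> real) \<Rightarrow> real \<Rightarrow> real" where
  "flux V \<phi> r = V * r * \<phi> r"

text \<open>The position \<open>x\<^sup>\<sharp> = x + l / Q(x)\<close> of the leader of the car located at \<open>x\<close>.\<close>

definition leader_pos :: "real \<Rightarrow> (real \<Rightarrow> real) \<Rightarrow> real \<Rightarrow> real" where
  "leader_pos l Q x = x + l / Q x"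

text \<open>
  Profiles are continuous, may have kinks, and satisfy the equation with the left derivative.
  The equation is not imposed where \<open>x = 0\<close> or \<open>x\<^sup>\<sharp> = 0\<close>; since \<open>l > 0\<close> and \<open>Q > 0\<close>,
  the two cases below are disjoint and cover all other points.
\<close>

definition is_profile ::
  "real \<Rightarrow> real \<Rightarrow> real \<Rightarrow> (real \<Rightarrow> real) \<Rightarrow> (real \<Rightarrow> real) \<Rightarrow> bool" where
  "is_profile l Vm Vp \<phi> Q \<longleftrightarrow>
     (\<forall>x. Q x \<in> {0<..<1}) \<and>
     continuous_on UNIV Q \<and>
     (\<forall>x. leader_pos l Q x < 0 \<or> x > 0 \<longrightarrow>
        (Q has_real_derivative
           (Q x)\<^sup>2 / (l * \<phi> (Q x)) * (\<phi> (Q x) - \<phi> (Q (leader_pos l Q x)))) (at_left x)) \<and>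
     (\<forall>x. x < 0 \<and> 0 < leader_pos l Q x \<longrightarrow>
        (Q has_real_derivative
           (Q x)\<^sup>2 / (l * Vm * \<phi> (Q x)) *
             (Vm * \<phi> (Q x) - Vp * \<phi> (Q (leader_pos l Q x)))) (at_left x))"

end

theory Submission
  imports Defs
begin

text \<open>
  Let \<open>T(x)\<close> be the time a car needs to travel from \<open>x\<close> to \<open>x\<^sup>\<sharp>\<close>, that is, the integral of
  \<open>1 / (V \<phi>(Q))\<close> over \<open>[x, x\<^sup>\<sharp>]\<close>. The profile equation says exactly that \<open>T' = 0\<close> wherever it
  is imposed. The position \<open>x\<^sup>\<sharp>\<close> has positive left derivative away from the exceptional points,
  so it is nondecreasing; hence the points with \<open>x\<^sup>\<sharp> = 0\<close> form an interval, on which \<open>T\<close> can only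
  decrease. Altogether \<open>T\<close> is nonincreasing.
  At the last point where \<open>Q = \<rho>\<^sup>*\<close> we have \<open>Q \<le> \<rho>\<^sup>*\<close> from there on, so \<open>T\<close> is at most
  \<open>l / f\<^sub>+(\<rho>\<^sup>*)\<close>, whereas near \<open>+\<infinity>\<close> it is close to
  \<open>l / f\<^sub>+(\<rho>\<^sub>+)\<close>, which is larger because \<open>f\<^sub>+\<close> increases up to \<open>\<rho>\<^sup>*\<close>.
\<close>

section \<open>Monotonicity from the sign of left derivatives\<close>

text \<open>
  The image of the exceptional set is required to be countable, rather than the set itself, since
  the leader position may be constant on a whole interval of exceptional points.
\<close>

lemma left_deriv_pos_imp_le:
  fixes f :: "real \<Rightarrow> real"
  assumes "a \<le> b" and cont: "continuous_on {a..b} f" and "countable (f ` S)"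
    and deriv: "\<And>x. a < x \<Longrightarrow> x \<le> b \<Longrightarrow> x \<notin> S \<Longrightarrow>
      \<exists>d>0. (f has_real_derivative d) (at_left x)"
  shows "f a \<le> f b"
proof (rule ccontr)
  assume "\<not> f a \<le> f b"
  \<comment> \<open>The countably many exceptional values cannot fill the interval, so some level
    \<open>c\<close> in it is attained only outside \<open>S\<close>.\<close>
  then have "uncountable ({f b<..<f a} - f ` S)"
    using uncountable_minus_countable[OF _ \<open>countable (f ` S)\<close>] uncountable_open_interval by simp
  then obtain c where c: "f b < c" "c < f a" "c \<notin> f ` S"
    by (metis DiffE countable_empty ex_in_conv greaterThanLessThan_iff)
  define K where "K = {x \<in> {a..b}. f x = c}"
  have "compact K"
    unfolding K_def using continuous_closed_preimage_constant[OF cont closed_atLeastAtMost, of c]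
    by (auto simp: compact_eq_bounded_closed intro: bounded_subset[OF bounded_closed_interval])
  moreover have "K \<noteq> {}"
    using IVT2'[of f b c a] c \<open>a \<le> b\<close> cont unfolding K_def by auto
  ultimately obtain s where s: "s \<in> K" "\<And>t. t \<in> K \<Longrightarrow> s \<le> t"
    by (meson compact_attains_inf)
  have "a \<le> s" "s \<le> b" and fs: "f s = c"
    using s(1) by (simp_all add: K_def)
  moreover have "a \<noteq> s"
    using fs c(2) by blast
  moreover have "s \<notin> S"
    using fs c(3) by blast
  ultimately have sab: "a < s" "s \<le> b" "f s = c" "s \<notin> S"
    by simp_all
  obtain d where "d > 0" "(f has_real_derivative d) (at_left s)"
    using deriv[OF sab(1,2,4)] by blast
  then obtain e where e: "e > 0" "\<And>h. h > 0 \<Longrightarrow> h < e \<Longrightarrow> f (s - h) < f s"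
    using has_real_derivative_pos_inc_left[of f d s "{..<s}"] by auto
  define h where "h = min (e / 2) (s - a)"
  have h: "h > 0" "h < e" "a \<le> s - h"
    using e sab unfolding h_def by auto
  have "continuous_on {a..s - h} f"
    using cont h sab by (elim continuous_on_subset) auto
  \<comment> \<open>Just left of the first point \<open>s\<close> at level \<open>c\<close>,
    \<open>f\<close> is below \<open>c\<close>, while \<open>f a\<close> is above it, so level
    \<open>c\<close> is already attained before \<open>s\<close>.\<close>
  then obtain z where "a \<le> z" "z \<le> s - h" "f z = c"
    using IVT2'[of f "s - h" c a] e(2)[OF h(1,2)] c sab h(3) by auto
  then have "z \<in> K"
    using h sab unfolding K_def by auto
  then show False
    using s(2)[of z] \<open>z \<le> s - h\<close> h by auto
qed

text \<open>Adding a small slope \<open>k * x\<close> makes the left derivatives positive and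
  reduces this to the strict case, with an error that tends to 0 with \<open>k\<close>.\<close>

lemma left_deriv_nonneg_imp_le:
  fixes f :: "real \<Rightarrow> real"
  assumes "a \<le> b" and cont: "continuous_on {a..b} f" and "countable S"
    and deriv: "\<And>x. a < x \<Longrightarrow> x \<le> b \<Longrightarrow> x \<notin> S \<Longrightarrow>
      \<exists>d\<ge>0. (f has_real_derivative d) (at_left x)"
  shows "f a \<le> f b"
proof (rule field_le_epsilon)
  fix e :: real
  assume "e > 0"
  \<comment> \<open>The summand 1 keeps the denominator positive when \<open>a = b\<close>.\<close>
  define k where "k = e / (b - a + 1)"
  have k: "k > 0" "k * (b - a) \<le> e"
    using \<open>e > 0\<close> \<open>a \<le> b\<close> unfolding k_def by (auto simp: field_simps)
  have "f a + k * a \<le> f b + k * b"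
  proof (rule left_deriv_pos_imp_le[of a b "\<lambda>x. f x + k * x" S])
    fix x assume "a < x" "x \<le> b" "x \<notin> S"
    then obtain d where "d \<ge> 0" "(f has_real_derivative d) (at_left x)"
      using deriv by blast
    then show "\<exists>d>0. ((\<lambda>x. f x + k * x) has_real_derivative d) (at_left x)"
      using k by (intro exI[of _ "d + k"]) (auto intro!: derivative_eq_intros)
  qed (use assms in \<open>auto intro!: continuous_intros\<close>)
  then show "f a \<le> f b + e"
    using k by (simp add: algebra_simps)
qed

section \<open>Calculus on the unit interval and growth of the flux\<close>

lemma has_real_derivative_deriv01:
  assumes "g differentiable_on {0..1}" "r \<in> {0..1}"
  shows "(g has_real_derivative deriv01 g r) (at r within {0..1})"
proof -
  have "g differentiable (at r within {0..1})"
    using assms by (auto simp: differentiable_on_def)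
  then show ?thesis
    unfolding deriv01_def
    by (simp add: has_real_derivative_iff_has_vector_derivative vector_derivative_works)
qed

lemma deriv01_eq:
  assumes "(g has_real_derivative d) (at r within {0..1})" "r \<in> {0..1}"
  shows "deriv01 g r = d"
  unfolding deriv01_def
  by (rule vector_derivative_within_closed_interval[OF zero_less_one assms(2)
      assms(1)[unfolded has_real_derivative_iff_has_vector_derivative]])

lemma strict_antimono_of_deriv01_neg:
  assumes "g differentiable_on {0..1}" "\<And>r. r \<in> {0..1} \<Longrightarrow> deriv01 g r < 0"
    and "0 \<le> a" "a < b" "b \<le> 1"
  shows "g b < g a"
proof (rule DERIV_neg_imp_decreasing_open[OF \<open>a < b\<close>])
  fix x assume "a < x" "x < b"
  then have "x \<in> interior {0..1}" "x \<in> {0..1}"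
    using assms by auto
  then show "\<exists>y. (g has_real_derivative y) (at x) \<and> y < 0"
    using has_real_derivative_deriv01[OF assms(1), of x] assms(2)[of x] at_within_interior by metis
next
  show "continuous_on {a..b} g"
    using differentiable_imp_continuous_on[OF assms(1)] assms(3,5)
    by (elim continuous_on_subset) auto
qed

text \<open>By concavity the derivative of the flux is strictly decreasing, hence positive to the
  left of its zero \<open>s\<close>.\<close>

lemma flux_less_of_critical:
  assumes diff: "\<phi> differentiable_on {0..1}" "deriv01 \<phi> differentiable_on {0..1}"
    and concave: "\<And>r. r \<in> {0..1} \<Longrightarrow> deriv01 (deriv01 (flux V \<phi>)) r < 0"
    and crit: "deriv01 (flux V \<phi>) s = 0"
    and "0 < r" "r < s" "s \<le> 1"
  shows "flux V \<phi> r < flux V \<phi> s"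
proof -
  have fderiv: "(flux V \<phi> has_real_derivative V * \<phi> x + V * x * deriv01 \<phi> x) (at x within {0..1})"
    if "x \<in> {0..1}" for x
    unfolding flux_def using has_real_derivative_deriv01[OF diff(1) that]
    by (auto intro!: derivative_eq_intros)
  have fdiff: "flux V \<phi> differentiable_on {0..1}"
    unfolding differentiable_on_def using fderiv real_differentiable_def by blast
  \<comment> \<open>A bound on \<open>deriv01 (deriv01 ...)\<close> says something only where the
    inner function is differentiable; the product rule formula provides this.\<close>
  have "(\<lambda>x. V * \<phi> x + V * x * deriv01 \<phi> x) differentiable_on {0..1}"
    using diff by (intro derivative_intros)
  then have ddiff: "deriv01 (flux V \<phi>) differentiable_on {0..1}"
    unfolding differentiable_on_def
    by (auto intro: differentiable_transform_within[where d = 1] simp: deriv01_eq[OF fderiv])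
  show ?thesis
  proof (rule DERIV_pos_imp_increasing_open[OF \<open>r < s\<close>])
    fix x assume "r < x" "x < s"
    then have "x \<in> interior {0..1}" "x \<in> {0..1}"
      using assms by auto
    moreover have "deriv01 (flux V \<phi>) s < deriv01 (flux V \<phi>) x"
      using strict_antimono_of_deriv01_neg[OF ddiff concave, of x s] assms \<open>r < x\<close> \<open>x < s\<close> by auto
    ultimately show "\<exists>y. (flux V \<phi> has_real_derivative y) (at x) \<and> y > 0"
      using has_real_derivative_deriv01[OF fdiff, of x] crit at_within_interior by metis
  next
    show "continuous_on {r..s} (flux V \<phi>)"
      using differentiable_imp_continuous_on[OF fdiff] assms
      by (elim continuous_on_subset) auto
  qed
qed

section \<open>Motion of the leader and monotonicity of the travel time\<close>

text \<open>Here \<open>v\<close> is the speed of the car at a given position. Substituting the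
  profile equation into \<open>1 - l * Q' / Q^2\<close> leaves the ratio of the leader's speed to
  the follower's.\<close>

lemma leader_pos_has_left_deriv:
  assumes prof: "is_profile l Vm Vp \<phi> Q" and "l > 0" "Vm > 0" "Vp > 0"
    and pos: "\<And>r. r \<in> {0<..<1} \<Longrightarrow> \<phi> r > 0"
    and x: "x \<noteq> 0" "leader_pos l Q x \<noteq> 0"
  defines "u \<equiv> leader_pos l Q"
    and "v \<equiv> \<lambda>z. (if z < 0 then Vm else Vp) * \<phi> (Q z)"
  shows "(u has_real_derivative v (u x) / v x) (at_left x)"
proof -
  have Q: "Q z \<in> {0<..<1}" for z
    using prof by (auto simp: is_profile_def)
  have Qx: "Q x > 0" "\<phi> (Q x) > 0"
    using Q[of x] pos[of "Q x"] by auto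
  have xu: "x < u x"
    using Qx \<open>l > 0\<close> unfolding u_def leader_pos_def by simp
  have *: "(u has_real_derivative 1 - l * q / (Q x)\<^sup>2) (at_left x)"
    if "(Q has_real_derivative q) (at_left x)" for q
    unfolding u_def leader_pos_def using that Qx
    by (auto intro!: derivative_eq_intros simp: power2_eq_square field_simps)
  show ?thesis
  proof (cases "u x < 0 \<or> x > 0")
    \<comment> \<open>Since \<open>x < u x\<close>, both cars are on the same side of the origin, so
      the speed limit cancels from the ratio.\<close>
    case True
    then have "(Q has_real_derivative
        (Q x)\<^sup>2 / (l * \<phi> (Q x)) * (\<phi> (Q x) - \<phi> (Q (u x)))) (at_left x)"
      using prof unfolding is_profile_def u_def by blast
    moreover have "1 - l * ((Q x)\<^sup>2 / (l * \<phi> (Q x)) * (\<phi> (Q x) - \<phi> (Q (u x)))) / (Q x)\<^sup>2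
        = \<phi> (Q (u x)) / \<phi> (Q x)"
      using Qx \<open>l > 0\<close> by (simp add: field_simps)
    moreover have "v (u x) / v x = \<phi> (Q (u x)) / \<phi> (Q x)"
      using True xu \<open>Vm > 0\<close> \<open>Vp > 0\<close> unfolding v_def by auto
    ultimately show ?thesis
      using * by metis
  next
    case False
    then have "x < 0 \<and> 0 < u x"
      using x unfolding u_def by auto
    then have "(Q has_real_derivative
        (Q x)\<^sup>2 / (l * Vm * \<phi> (Q x)) * (Vm * \<phi> (Q x) - Vp * \<phi> (Q (u x)))) (at_left x)"
      using prof unfolding is_profile_def u_def by blast
    moreover have "1 - l * ((Q x)\<^sup>2 / (l * Vm * \<phi> (Q x)) *
        (Vm * \<phi> (Q x) - Vp * \<phi> (Q (u x)))) / (Q x)\<^sup>2 = v (u x) / v x"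
      using Qx \<open>l > 0\<close> \<open>Vm > 0\<close> \<open>x < 0 \<and> 0 < u x\<close> unfolding v_def by (simp add: field_simps)
    ultimately show ?thesis
      using * by metis
  qed
qed

text \<open>The speed ratio is positive. The exceptional points may be uncountable, but
  \<open>?u\<close> takes at most two values on them: 0 and \<open>?u 0\<close>.\<close>

lemma leader_pos_mono:
  assumes prof: "is_profile l Vm Vp \<phi> Q" and "l > 0" "Vm > 0" "Vp > 0"
    and pos: "\<And>r. r \<in> {0<..<1} \<Longrightarrow> \<phi> r > 0"
    and "x \<le> y"
  shows "leader_pos l Q x \<le> leader_pos l Q y"
proof (rule left_deriv_pos_imp_le[OF \<open>x \<le> y\<close>])
  let ?u = "leader_pos l Q"
  let ?S = "{z. z = 0 \<or> ?u z = 0}"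
  have Q: "Q z \<in> {0<..<1}" for z
    using prof by (auto simp: is_profile_def)
  have "?u ` ?S \<subseteq> {0, ?u 0}"
    by auto
  then show "countable (?u ` ?S)"
    by (meson countable_finite finite.emptyI finite.insertI finite_subset)
  have "continuous_on {x..y} Q"
    using prof by (auto simp: is_profile_def intro: continuous_on_subset)
  moreover have "Q z \<noteq> 0" for z
    using Q[of z] by auto
  ultimately show "continuous_on {x..y} ?u"
    unfolding leader_pos_def by (intro continuous_intros) auto
  fix z assume "z \<notin> ?S"
  then show "\<exists>d>0. (?u has_real_derivative d) (at_left z)"
    using leader_pos_has_left_deriv[OF prof \<open>l > 0\<close> \<open>Vm > 0\<close> \<open>Vp > 0\<close> pos, of z] pos[OF Q] assms(3,4)
    by (intro exI conjI, assumption?) (auto intro!: divide_pos_pos mult_pos_pos)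
qed

text \<open>As \<open>G\<close> is a primitive of the slowness \<open>1 / v\<close>, the difference
  \<open>G (u x) - G x\<close> is the travel time from a car to its leader's position.\<close>

lemma travel_time_antimono:
  assumes prof: "is_profile l Vm Vp \<phi> Q" and "l > 0" "Vm > 0" "Vp > 0"
    and pos: "\<And>r. r \<in> {0<..<1} \<Longrightarrow> \<phi> r > 0"
    and contG: "continuous_on UNIV G"
    and G: "\<And>z. z \<noteq> 0 \<Longrightarrow>
      (G has_real_derivative 1 / ((if z < 0 then Vm else Vp) * \<phi> (Q z))) (at z)"
    and "x \<le> y"
  shows "G (leader_pos l Q y) - G y \<le> G (leader_pos l Q x) - G x"
proof -
  define u where "u = leader_pos l Q"
  define v where "v = (\<lambda>z. (if z < 0 then Vm else Vp) * \<phi> (Q z))"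
  \<comment> \<open>Of the zeros of \<open>u\<close> only the first, if there is one, has to be
    excluded, so \<open>S\<close> has at most two points even when \<open>u\<close> vanishes on an
    interval.\<close>
  define S where "S = {0} \<union> {z. u z = 0 \<and> (\<forall>w<z. u w \<noteq> 0)}"
  have Q: "Q z \<in> {0<..<1}" for z
    using prof by (auto simp: is_profile_def)
  have Q0: "Q z \<noteq> 0" for z
    using Q[of z] by auto
  have v: "v z > 0" for z
    using pos[OF Q] assms(3,4) by (auto simp: v_def)
  have mono: "u w \<le> u z" if "w \<le> z" for w z
    unfolding u_def using leader_pos_mono assms that by blast
  have contQ: "continuous_on UNIV Q"
    using prof by (auto simp: is_profile_def)
  have contu: "continuous_on UNIV u"
    unfolding u_def leader_pos_def using contQ Q0 by (intro continuous_intros) auto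
  have "- (G (u x) - G x) \<le> - (G (u y) - G y)"
  proof (rule left_deriv_nonneg_imp_le[OF \<open>x \<le> y\<close>])
    have "z = w" if "z \<in> S - {0}" "w \<in> S - {0}" for z w
      using that unfolding S_def by (auto dest: linorder_neqE)
    then have "\<exists>z. S \<subseteq> {0, z}"
      by blast
    then show "countable S"
      by (meson countable_finite finite.emptyI finite.insertI finite_subset)
    have "continuous_on UNIV (\<lambda>z. - (G (u z) - G z))"
      using continuous_on_compose2[OF contG contu] contG by (intro continuous_intros) auto
    then show "continuous_on {x..y} (\<lambda>z. - (G (u z) - G z))"
      by (rule continuous_on_subset) auto
    fix z assume "z \<notin> S"
    then have "z \<noteq> 0"
      by (auto simp: S_def)
    have Gz: "(G has_real_derivative 1 / v z) (at_left z)"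
      using G[OF \<open>z \<noteq> 0\<close>] unfolding v_def by (rule has_field_derivative_at_within)
    show "\<exists>d\<ge>0. ((\<lambda>z. - (G (u z) - G z)) has_real_derivative d) (at_left z)"
    proof (cases "u z = 0")
      case True
      then obtain w where "w < z" "u w = 0"
        using \<open>z \<notin> S\<close> by (auto simp: S_def)
      \<comment> \<open>Monotonicity squeezes \<open>u\<close> to 0 between two of its zeros. The
        end of the trip then stays at 0 while its start advances, so the travel time drops at rate
        \<open>1 / v z\<close>.\<close>
      then have "u t = 0" if "w < t" "t \<le> z" for t
        using mono[of w t] mono[of t z] True that by auto
      then have "\<forall>\<^sub>F t in at_left z. u t = 0"
        using \<open>w < z\<close> by (intro eventually_at_leftI[of w]) auto
      moreover have "((\<lambda>z. - (G 0 - G z)) has_real_derivative 1 / v z) (at_left z)"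
        using Gz by (auto intro!: derivative_eq_intros)
      ultimately have "((\<lambda>z. - (G (u z) - G z)) has_real_derivative 1 / v z) (at_left z)"
        using True
        by (subst has_field_derivative_cong_eventually) (auto elim: eventually_mono)
      then show ?thesis
        using v[of z] by (intro exI[of _ "1 / v z"]) auto
    next
      case False
      have "(G has_real_derivative 1 / v (u z)) (at (u z))"
        using G[OF False] by (simp add: v_def)
      moreover have "(u has_real_derivative v (u z) / v z) (at_left z)"
        using leader_pos_has_left_deriv[OF prof \<open>l > 0\<close> \<open>Vm > 0\<close> \<open>Vp > 0\<close> pos \<open>z \<noteq> 0\<close>] False
        unfolding u_def v_def by simp
      \<comment> \<open>The factor \<open>v (u z)\<close> cancels, which leaves exactly the left
        derivative \<open>1 / v z\<close> of \<open>G\<close>.\<close>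
      ultimately have "((\<lambda>z. G (u z)) has_real_derivative 1 / v (u z) * (v (u z) / v z)) (at_left z)"
        by (rule DERIV_chain2)
      then have "((\<lambda>z. - (G (u z) - G z)) has_real_derivative 0) (at_left z)"
        using Gz v[of "u z"] by (auto intro!: derivative_eq_intros)
      then show ?thesis
        by blast
    qed
  qed
  then show ?thesis
    by (simp add: u_def)
qed

section \<open>A primitive across the jump of the speed limit, and the last crossing of a
  level\<close>

text \<open>A primitive \<open>H\<close> of \<open>h\<close> on the whole line, shifted to vanish at
  0, is divided by \<open>a\<close> on the left and by \<open>b\<close> on the right; both pieces
  are 0 at the origin and glue continuously.\<close>

lemma antiderivative_of_jump_at_0:
  fixes h :: "real \<Rightarrow> real"
  assumes "continuous_on UNIV h"
  obtains G where "continuous_on UNIV G"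
    and "\<And>z. z \<noteq> 0 \<Longrightarrow> (G has_real_derivative h z / (if z < 0 then a else b)) (at z)"
proof -
  have "\<exists>H. \<forall>z. - \<infinity> < ereal z \<longrightarrow> ereal z < \<infinity> \<longrightarrow> (H has_vector_derivative h z) (at z)"
    using assms by (intro einterval_antiderivative) (auto simp: continuous_on_eq_continuous_at)
  then obtain H where H: "\<And>z. (H has_real_derivative h z) (at z)"
    by (auto simp: has_real_derivative_iff_has_vector_derivative)
  define G where "G = (\<lambda>z. if z \<le> 0 then (H z - H 0) / a else (H z - H 0) / b)"
  have contH: "continuous_on S H" for S
    using H by (meson DERIV_isCont continuous_at_imp_continuous_on)
  have "continuous_on S (\<lambda>z. (H z - H 0) / c)" for S c
    unfolding divide_inverse by (intro continuous_intros contH)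
  then have "continuous_on UNIV G"
    unfolding G_def by (intro continuous_on_cases_le continuous_on_id) auto
  moreover have "(G has_real_derivative h z / (if z < 0 then a else b)) (at z)" if "z \<noteq> 0" for z
  proof (cases "z < 0")
    case True
    have "((\<lambda>z. (H z - H 0) / a) has_real_derivative h z / a) (at z)"
      by (auto intro!: derivative_eq_intros H DERIV_cdivide)
    then have "(G has_real_derivative h z / a) (at z)"
      by (rule has_field_derivative_transform_within_open[of _ _ _ "{..<0}"])
        (use True in \<open>auto simp: G_def\<close>)
    then show ?thesis
      using True by simp
  next
    case False
    have "((\<lambda>z. (H z - H 0) / b) has_real_derivative h z / b) (at z)"
      by (auto intro!: derivative_eq_intros H DERIV_cdivide)
    then have "(G has_real_derivative h z / b) (at z)"
      by (rule has_field_derivative_transform_within_open[of _ _ _ "{0<..}"])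
        (use False that in \<open>auto simp: G_def\<close>)
    then show ?thesis
      using False by simp
  qed
  ultimately show ?thesis
    using that by blast
qed

text \<open>The point is the supremum of the closed set \<open>r \<le> Q z\<close>, which the limit
  at \<open>at_bot\<close> makes nonempty and the limit at \<open>at_top\<close> bounds above. Being
  a right limit of values below \<open>r\<close>, the value there is also at most
  \<open>r\<close>.\<close>

lemma last_point_of_value:
  fixes Q :: "real \<Rightarrow> real"
  assumes cont: "continuous_on UNIV Q" and bot: "(Q \<longlongrightarrow> rm) at_bot" and top: "(Q \<longlongrightarrow> rp) at_top"
    and "rp < r" "r < rm"
  obtains x where "Q x = r" "\<And>z. x \<le> z \<Longrightarrow> Q z \<le> r"
proof -
  obtain w where w: "Q w > r"
    using order_tendstoD(1)[OF bot \<open>r < rm\<close>] by (auto simp: eventually_at_bot_linorder)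
  obtain B where B: "\<And>z. B \<le> z \<Longrightarrow> Q z < r"
    using order_tendstoD(2)[OF top \<open>rp < r\<close>] by (auto simp: eventually_at_top_linorder)
  define K where "K = {z. r \<le> Q z}"
  have "closed K"
    unfolding K_def using cont by (intro closed_Collect_le) auto
  moreover have bdd: "bdd_above K"
    using B unfolding K_def by (intro bdd_aboveI[of _ B]) (meson linorder_le_cases mem_Collect_eq not_le)
  moreover have "w \<in> K"
    using w by (simp add: K_def)
  ultimately have S: "Sup K \<in> K"
    using closed_contains_Sup by blast
  have after: "Q z < r" if "Sup K < z" for z
    using cSup_upper[OF _ bdd, of z] that unfolding K_def by force
  have "Q (Sup K) \<le> r"
  proof (rule tendsto_upperbound)
    show "(Q \<longlongrightarrow> Q (Sup K)) (at_right (Sup K))"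
      using cont by (simp add: continuous_on_def filterlim_at_split)
    show "\<forall>\<^sub>F z in at_right (Sup K). Q z \<le> r"
      using after by (intro eventually_at_rightI[of _ "Sup K + 1"]) (auto simp: less_imp_le)
  qed simp
  then have "Q (Sup K) = r"
    using S by (auto simp: K_def)
  then show ?thesis
    using that[of "Sup K"] after by (metis order_le_less order_refl)
qed

section \<open>Travel times at the last crossing of \<open>rs\<close> and far downstream\<close>

theorem theorem3p5:
  fixes l Vm Vp rm rp rs c0 c0hat :: real
    and \<phi> :: "real \<Rightarrow> real"
  assumes "l > 0"
    and "\<phi> ` {0..1} \<subseteq> {0..1}"
    and "\<phi> differentiable_on {0..1}"
    and "deriv01 \<phi> differentiable_on {0..1}"
    and "c0hat > 0"
    and "\<And>r. r \<in> {0..1} \<Longrightarrow> deriv01 \<phi> r \<le> - c0hat"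
    and "\<phi> 0 = 1"
    and "\<phi> 1 = 0"
    and "c0 > 0"
    and "\<And>r. r \<in> {0..1} \<Longrightarrow> deriv01 (deriv01 (flux Vm \<phi>)) r \<le> - c0"
    and "\<And>r. r \<in> {0..1} \<Longrightarrow> deriv01 (deriv01 (flux Vp \<phi>)) r \<le> - c0"
    and "rs \<in> {0<..<1}"
    and "\<And>r. r \<in> {0<..<1} \<Longrightarrow>
           deriv01 (flux Vm \<phi>) r = 0 \<and> deriv01 (flux Vp \<phi>) r = 0 \<longleftrightarrow> r = rs"
    and "Vm > Vp" and "Vp > 0"
    and "0 < rp" and "rp < rs" and "rs < rm" and "rm < 1"
    and "flux Vm \<phi> rm = flux Vp \<phi> rp"
  shows "\<not> (\<exists>Q. is_profile l Vm Vp \<phi> Q \<and> (Q \<longlongrightarrow> rm) at_bot \<and> (Q \<longlongrightarrow> rp) at_top)"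
proof
  assume "\<exists>Q. is_profile l Vm Vp \<phi> Q \<and> (Q \<longlongrightarrow> rm) at_bot \<and> (Q \<longlongrightarrow> rp) at_top"
  then obtain Q where prof: "is_profile l Vm Vp \<phi> Q"
    and bot: "(Q \<longlongrightarrow> rm) at_bot" and top: "(Q \<longlongrightarrow> rp) at_top"
    by blast
  have "Vm > 0"
    using \<open>Vm > Vp\<close> \<open>Vp > 0\<close> by simp
  have \<phi>_less: "\<phi> b < \<phi> a" if "0 \<le> a" "a < b" "b \<le> 1" for a b
  proof (rule strict_antimono_of_deriv01_neg[OF assms(3) _ that])
    show "deriv01 \<phi> r < 0" if "r \<in> {0..1}" for r
      using assms(6)[OF that] \<open>c0hat > 0\<close> by simp
  qed
  have \<phi>_le: "\<phi> b \<le> \<phi> a" if "0 \<le> a" "a \<le> b" "b \<le> 1" for a b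
    using \<phi>_less[of a b] that by (cases "a = b") auto
  have \<phi>_pos: "\<phi> r > 0" if "r \<in> {0<..<1}" for r
    using \<phi>_less[of r 1] that \<open>\<phi> 1 = 0\<close> by simp
  have Q: "Q z \<in> {0<..<1}" for z
    using prof by (auto simp: is_profile_def)
  then have Q01: "0 < Q z" "Q z < 1" for z
    by auto
  have contQ: "continuous_on UNIV Q"
    using prof by (auto simp: is_profile_def)
  have cont\<phi>: "continuous_on {0..1} \<phi>"
    using assms(3) by (rule differentiable_imp_continuous_on)
  have "continuous_on UNIV (\<lambda>z. \<phi> (Q z))"
    by (rule continuous_on_compose2[OF cont\<phi> contQ]) (use Q01 in \<open>auto simp: less_imp_le\<close>)
  then have "continuous_on UNIV (\<lambda>z. 1 / \<phi> (Q z))"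
    using \<phi>_pos[OF Q] by (intro continuous_intros) (auto simp: less_imp_neq[symmetric])
  then obtain G where contG: "continuous_on UNIV G"
    and "\<And>z. z \<noteq> 0 \<Longrightarrow>
      (G has_real_derivative 1 / \<phi> (Q z) / (if z < 0 then Vm else Vp)) (at z)"
    using antiderivative_of_jump_at_0[of "\<lambda>z. 1 / \<phi> (Q z)" Vm Vp] by blast
  then have G: "\<And>z. z \<noteq> 0 \<Longrightarrow>
      (G has_real_derivative 1 / ((if z < 0 then Vm else Vp) * \<phi> (Q z))) (at z)"
    by (simp add: mult.commute)
  define u where "u = leader_pos l Q"
  have u: "u z - z = l / Q z" "z \<le> u z" for z
    using Q01[of z] \<open>l > 0\<close> unfolding u_def leader_pos_def by auto

  have rs01: "0 < rs" "rs < 1"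
    using \<open>rs \<in> {0<..<1}\<close> by auto
  have rsphi: "\<phi> rs > 0"
    using \<phi>_pos \<open>rs \<in> {0<..<1}\<close> .
  have "flux Vp \<phi> rp < flux Vp \<phi> rs"
  proof (rule flux_less_of_critical[OF assms(3,4)])
    show "deriv01 (deriv01 (flux Vp \<phi>)) r < 0" if "r \<in> {0..1}" for r
      using assms(11)[OF that] \<open>c0 > 0\<close> by simp
    show "deriv01 (flux Vp \<phi>) rs = 0"
      using assms(13)[of rs] \<open>rs \<in> {0<..<1}\<close> by simp
  qed (use assms rs01 in auto)
  then have flux: "rp * \<phi> rp < rs * \<phi> rs"
    using \<open>Vp > 0\<close> by (simp add: flux_def)

  obtain x where x: "Q x = rs" "\<And>z. x \<le> z \<Longrightarrow> Q z \<le> rs"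
    using last_point_of_value[OF contQ bot top \<open>rp < rs\<close> \<open>rs < rm\<close>] by blast
  \<comment> \<open>This is the largest possible slowness on \<open>[x, u x]\<close>: there
    \<open>Q \<le> rs\<close> gives \<open>\<phi> (Q z) \<ge> \<phi> rs\<close>, and the speed limit
    is at least \<open>Vp\<close> on either side of the origin.\<close>
  define k where "k = 1 / (Vp * \<phi> rs)"
  have "x * k - G x \<le> u x * k - G (u x)"
  proof (rule left_deriv_nonneg_imp_le[OF u(2), where S = "{0}"])
    fix z assume z: "x < z" "z \<notin> {0}"
    define v where "v = (if z < 0 then Vm else Vp) * \<phi> (Q z)"
    have "Vp * \<phi> rs \<le> v"
      unfolding v_def using \<open>Vm > Vp\<close> \<open>Vp > 0\<close> \<phi>_le[of "Q z" rs] x(2)[of z] z(1) Q01[of z] rs01 rsphi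
      by (intro mult_mono) auto
    moreover have "Vp * \<phi> rs > 0"
      using \<open>Vp > 0\<close> rsphi by simp
    ultimately have "1 / v \<le> k"
      unfolding k_def by (intro divide_left_mono) auto
    moreover have "(G has_real_derivative 1 / v) (at_left z)"
      using has_field_derivative_at_within[OF G[of z]] z(2) unfolding v_def by blast
    then have "((\<lambda>z. z * k - G z) has_real_derivative k - 1 / v) (at_left z)"
      by (auto intro!: derivative_eq_intros)
    ultimately show "\<exists>d\<ge>0. ((\<lambda>z. z * k - G z) has_real_derivative d) (at_left z)"
      by (intro exI[of _ "k - 1 / v"]) simp
  qed (auto intro!: continuous_intros continuous_on_subset[OF contG])
  then have "G (u x) - G x \<le> (u x - x) * k"
    by (simp add: left_diff_distrib)
  then have upper: "G (u x) - G x \<le> l / (Vp * (rs * \<phi> rs))"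
    unfolding u(1) x(1) k_def by (simp add: mult_ac)

  \<comment> \<open>Room \<open>e\<close> is chosen around \<open>rp\<close> so that the strict flux
    inequality survives the worst case: density bounded by \<open>rp + e\<close>, and, as
    \<open>\<phi>\<close> decreases, \<open>\<phi> (Q z)\<close> bounded by
    \<open>\<phi> (rp - e)\<close>.\<close>
  have "isCont \<phi> rp"
    using continuous_on_interior[OF cont\<phi>, of rp] assms(16,17) rs01 by auto
  then have "((\<lambda>e. (rp + e) * \<phi> (rp - e)) \<longlongrightarrow> (rp + 0) * \<phi> rp) (at_right 0)"
    by (intro tendsto_intros isCont_tendsto_compose[of rp \<phi>]) (auto intro!: tendsto_eq_intros)
  then have "\<forall>\<^sub>F e in at_right 0. (rp + e) * \<phi> (rp - e) < rs * \<phi> rs"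
    using order_tendstoD(2) flux by fastforce
  moreover have "\<forall>\<^sub>F e in at_right 0. e < rp"
    using \<open>0 < rp\<close> by (intro eventually_at_rightI[of 0 rp]) auto
  moreover have "\<forall>\<^sub>F e in at_right 0. e > (0::real)"
    by (intro eventually_at_rightI[of 0 1]) auto
  ultimately have "\<forall>\<^sub>F e in at_right 0. (rp + e) * \<phi> (rp - e) < rs * \<phi> rs \<and> e < rp \<and> 0 < e"
    by eventually_elim simp
  then obtain e where e: "(rp + e) * \<phi> (rp - e) < rs * \<phi> rs" "e < rp" "0 < e"
    using eventually_happens[of _ "at_right (0::real)"] trivial_limit_at_right_real by blast
  have low_pos: "\<phi> (rp - e) > 0"
    using \<phi>_pos[of "rp - e"] e assms(17) rs01 by simp
  have "\<forall>\<^sub>F z in at_top. rp - e < Q z \<and> Q z < rp + e"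
    using order_tendstoD[OF top] e(3) by (intro eventually_conj) auto
  then obtain B where B: "\<And>z. B \<le> z \<Longrightarrow> rp - e < Q z \<and> Q z < rp + e"
    by (auto simp: eventually_at_top_linorder)
  \<comment> \<open>The bound \<open>B\<close> gives closeness to \<open>rp\<close>,
    \<open>x\<close> allows comparison with the travel time at \<open>x\<close>, and 1 keeps the
    trip in the region with speed limit \<open>Vp\<close>.\<close>
  define y where "y = max B (max x 1)"
  \<comment> \<open>A lower bound for the slowness beyond \<open>y\<close>, the counterpart of
    \<open>k\<close>.\<close>
  define m where "m = 1 / (Vp * \<phi> (rp - e))"
  have "G y - y * m \<le> G (u y) - u y * m"
  proof (rule left_deriv_nonneg_imp_le[OF u(2), where S = "{}"])
    fix z assume "y < z"
    then have z: "z > 0" "B \<le> z"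
      by (auto simp: y_def)
    have "\<phi> (Q z) \<le> \<phi> (rp - e)"
      using B[OF z(2)] e Q01[of z] by (intro \<phi>_le) auto
    then have "m \<le> 1 / (Vp * \<phi> (Q z))"
      unfolding m_def using \<open>Vp > 0\<close> low_pos \<phi>_pos[OF Q]
      by (intro divide_left_mono mult_left_mono mult_pos_pos) auto
    moreover have "(G has_real_derivative 1 / (Vp * \<phi> (Q z))) (at_left z)"
      using has_field_derivative_at_within[OF G[of z]] z(1) by simp
    then have "((\<lambda>z. G z - z * m) has_real_derivative 1 / (Vp * \<phi> (Q z)) - m) (at_left z)"
      by (auto intro!: derivative_eq_intros)
    ultimately show "\<exists>d\<ge>0. ((\<lambda>z. G z - z * m) has_real_derivative d) (at_left z)"
      by (intro exI[of _ "1 / (Vp * \<phi> (Q z)) - m"]) simp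
  qed (auto intro!: continuous_intros continuous_on_subset[OF contG])
  then have "(u y - y) * m \<le> G (u y) - G y"
    by (simp add: left_diff_distrib)
  then have lower: "l / (Vp * (Q y * \<phi> (rp - e))) \<le> G (u y) - G y"
    unfolding u(1) m_def by (simp add: mult_ac)

  have "Q y * \<phi> (rp - e) \<le> (rp + e) * \<phi> (rp - e)"
    using B[of y] low_pos by (intro mult_right_mono) (auto simp: y_def)
  then have "Vp * (Q y * \<phi> (rp - e)) < Vp * (rs * \<phi> rs)"
    using e(1) \<open>Vp > 0\<close> by simp
  \<comment> \<open>The upper bound at \<open>x\<close> is thus smaller than the lower bound at
    \<open>y\<close>, although the travel time cannot grow from \<open>x\<close> to
    \<open>y\<close>.\<close>
  then have "l / (Vp * (rs * \<phi> rs)) < l / (Vp * (Q y * \<phi> (rp - e)))"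
    using \<open>l > 0\<close> \<open>Vp > 0\<close> Q01[of y] low_pos rs01 rsphi
    by (intro divide_strict_left_mono mult_pos_pos) auto
  moreover have "G (u y) - G y \<le> G (u x) - G x"
    unfolding u_def
    using travel_time_antimono[OF prof \<open>l > 0\<close> \<open>Vm > 0\<close> \<open>Vp > 0\<close> \<phi>_pos contG G] by (simp add: y_def)
  ultimately show False
    using upper lower by simp
qed

end
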